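(* Let $d\ge1$ and, for $u_0\in\mathcal{M}_{\rm loc}(\mathbb{R}^d)$, let $$u(x,t)=\frac{1}{(4\pi t)^{d/2}}\int_{\mathbb{R}^d}e^{-|x-y|^2/4t}\,\mathrm{d}u_0(y).$$ (a) If $\varepsilon>0$, $u_0\in\mathcal{M}_\varepsilon(\mathbb{R}^d)$ and $T(\varepsilon)=\frac1{4\varepsilon}$, then for each $t\in(0,T(\varepsilon))$ we have $u(t)\in L^1_\delta(\mathbb{R}^d)$ for every $\delta>\varepsilon(t):=\frac{1}{4(T(\varepsilon)-t)}=\frac{\varepsilon}{1-4\varepsilon t}$. (b) Conversely, if $0\le u_0\in\mathcal{M}_{\rm loc}(\mathbb{R}^d)$ and $u(x,t)<\infty$ for some $x\in\mathbb{R}^d$ and $t>0$, then $u_0\in\mathcal{M}_\varepsilon(\mathbb{R}^d)$ for every $\varepsilon>\frac{1}{4t}$.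
   Context: $\mathcal{M}_{\rm loc}(\mathbb{R}^d)$ is the set of (signed) Radon measures on $\mathbb{R}^d$, identified with the dual of $C_c(\mathbb{R}^d)$; $|\mu|=\mu^++\mu^-$ is the total variation measure from the Jordan decomposition. For $\varepsilon>0$, $\mathcal{M}_\varepsilon(\mathbb{R}^d)=\{\mu\in\mathcal{M}_{\rm loc}(\mathbb{R}^d):\int e^{-\varepsilon|x|^2}\,\mathrm{d}|\mu|(x)<\infty\}$ and $L^1_\varepsilon(\mathbb{R}^d)=\{f\in L^1_{\rm loc}(\mathbb{R}^d):\int e^{-\varepsilon|x|^2}|f(x)|\,\mathrm{d}x<\infty\}$. For non-negative $u_0$ the integral defining $u(x,t)$ takes values in $[0,\infty]$. Write $u(t)=u(\cdot,t)$. *)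

theory Defs
  imports "HOL-Analysis.Analysis"
begin

section \<open>Signed Radon measures\<close>

text \<open>
  A signed Radon measure on a Euclidean space may have infinite positive \<^emph>\<open>and\<close> infinite
  negative mass, so it is in general not a set function on all Borel sets.  It is a real-valued
  set function on the bounded (that is, relatively compact) Borel sets which is
  \<open>\<sigma>\<close>-additive as long as the union stays bounded; these set functions are the ones that
  represent the dual of \<open>C\<^sub>c\<close>.  The values on other sets carry no meaning, and nothing
  below depends on them.
\<close>

definition bounded_borel :: "'a::euclidean_space set set" where
  "bounded_borel = {A. A \<in> sets borel \<and> bounded A}"

definition M_loc :: "('a::euclidean_space set \<Rightarrow> real) set" where
  "M_loc = {\<mu>. \<forall>A::nat \<Rightarrow> 'a set.
     range A \<subseteq> bounded_borel \<longrightarrow> disjoint_family A \<longrightarrow> bounded (\<Union>i. A i) \<longrightarrow>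
     (\<lambda>i. \<mu> (A i)) sums \<mu> (\<Union>i. A i)}"

definition nonneg_measure :: "('a::euclidean_space set \<Rightarrow> real) \<Rightarrow> bool" where
  "nonneg_measure \<mu> \<longleftrightarrow> (\<forall>A\<in>bounded_borel. 0 \<le> \<mu> A)"

text \<open>
  The Jordan decomposition \<open>\<mu> = \<mu>\<^sup>+ - \<mu>\<^sup>-\<close>.  That \<open>\<mu>\<^sup>+\<close>, \<open>\<mu>\<^sup>-\<close> and
  \<open>|\<mu>|\<close> are genuine measures with the stated values, finite on bounded sets, and that
  \<open>\<mu>\<close> is their difference, is checked in the lemmas that follow.
\<close>

definition pos_variation :: "('a::euclidean_space set \<Rightarrow> real) \<Rightarrow> 'a set \<Rightarrow> ennreal" where
  "pos_variation \<mu> E = (SUP B\<in>{B\<in>bounded_borel. B \<subseteq> E}. ennreal (\<mu> B))"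

definition pos_part :: "('a::euclidean_space set \<Rightarrow> real) \<Rightarrow> 'a measure" where
  "pos_part \<mu> = measure_of UNIV (sets borel) (pos_variation \<mu>)"

definition neg_part :: "('a::euclidean_space set \<Rightarrow> real) \<Rightarrow> 'a measure" where
  "neg_part \<mu> = pos_part (\<lambda>A. - \<mu> A)"

definition total_variation :: "('a::euclidean_space set \<Rightarrow> real) \<Rightarrow> 'a measure" where
  "total_variation \<mu> =
     measure_of UNIV (sets borel) (\<lambda>E. emeasure (pos_part \<mu>) E + emeasure (neg_part \<mu>) E)"

lemma sets_parts [simp, measurable_cong]:
  "sets (pos_part \<mu>) = sets borel" "sets (neg_part \<mu>) = sets borel"
  "sets (total_variation \<mu>) = sets borel"
  using sets.sigma_sets_eq[of borel] by (auto simp: pos_part_def neg_part_def total_variation_def)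

lemma space_parts [simp]:
  "space (pos_part \<mu>) = UNIV" "space (neg_part \<mu>) = UNIV" "space (total_variation \<mu>) = UNIV"
  by (auto simp: pos_part_def neg_part_def total_variation_def)

lemma bounded_borelI: "A \<in> sets borel \<Longrightarrow> bounded A \<Longrightarrow> A \<in> bounded_borel"
  by (simp add: bounded_borel_def)

lemma bounded_borel_subset:
  "A \<in> bounded_borel \<Longrightarrow> B \<in> sets borel \<Longrightarrow> B \<subseteq> A \<Longrightarrow> B \<in> bounded_borel"
  by (auto simp: bounded_borel_def intro: bounded_subset)

lemma bounded_borel_empty [simp]: "{} \<in> bounded_borel"
  by (simp add: bounded_borel_def)

lemma bounded_borel_Un: "A \<in> bounded_borel \<Longrightarrow> B \<in> bounded_borel \<Longrightarrow> A \<union> B \<in> bounded_borel"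
  by (auto simp: bounded_borel_def)

lemma M_loc_uminus: "\<mu> \<in> M_loc \<Longrightarrow> (\<lambda>A. - \<mu> A) \<in> M_loc"
  unfolding M_loc_def by (auto intro: sums_minus)

lemma M_loc_sums:
  assumes "\<mu> \<in> M_loc" "\<And>i::nat. A i \<in> bounded_borel" "disjoint_family A" "bounded (\<Union>i. A i)"
  shows "(\<lambda>i. \<mu> (A i)) sums \<mu> (\<Union>i. A i)"
  using assms unfolding M_loc_def by blast

lemma M_loc_empty: assumes "\<mu> \<in> M_loc" shows "\<mu> {} = 0"
proof -
  have "(\<lambda>i::nat. \<mu> {}) sums \<mu> (\<Union>i::nat. {})"
    by (rule M_loc_sums[OF assms]) (auto simp: disjoint_family_on_def)
  then have "summable (\<lambda>i::nat. \<mu> {})"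
    by (rule sums_summable)
  then show ?thesis
    by (simp add: summable_const_iff)
qed

lemma M_loc_Un:
  assumes "\<mu> \<in> M_loc" "A \<in> bounded_borel" "B \<in> bounded_borel" "A \<inter> B = {}"
  shows "\<mu> (A \<union> B) = \<mu> A + \<mu> B"
proof -
  let ?F = "binaryset A B"
  have "(\<lambda>i. \<mu> (?F i)) sums \<mu> (\<Union>i. ?F i)"
  proof (rule M_loc_sums[OF assms(1)])
    show "?F i \<in> bounded_borel" for i
      using assms by (auto simp: binaryset_def)
    show "disjoint_family ?F"
      using assms(4) unfolding disjoint_family_on_def binaryset_def by (auto split: if_splits)
    show "bounded (\<Union>i. ?F i)"
      using assms by (simp add: UN_binaryset_eq bounded_borel_def)
  qed
  moreover have "(\<lambda>i. \<mu> (?F i)) sums (\<mu> A + \<mu> B)"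
    by (rule binaryset_sums) (rule M_loc_empty[OF assms(1)])
  ultimately show ?thesis
    by (simp add: UN_binaryset_eq sums_unique2)
qed

lemma pos_variation_mono: "E \<subseteq> F \<Longrightarrow> pos_variation \<mu> E \<le> pos_variation \<mu> F"
  unfolding pos_variation_def by (rule SUP_subset_mono) auto

lemma pos_variation_upper:
  "B \<in> bounded_borel \<Longrightarrow> B \<subseteq> E \<Longrightarrow> ennreal (\<mu> B) \<le> pos_variation \<mu> E"
  unfolding pos_variation_def by (rule SUP_upper) auto

lemma pos_variation_empty: assumes "\<mu> \<in> M_loc" shows "pos_variation \<mu> {} = 0"
proof -
  have "{B \<in> bounded_borel. B \<subseteq> {}} = {{}::'a set}" by auto
  then show ?thesis by (simp add: pos_variation_def M_loc_empty[OF assms])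
qed

lemma pos_variation_superadditive:
  assumes \<mu>: "\<mu> \<in> M_loc" and disj: "A \<inter> B = {}"
  shows "pos_variation \<mu> A + pos_variation \<mu> B \<le> pos_variation \<mu> (A \<union> B)"
proof -
  let ?S = "\<lambda>E. {B\<in>bounded_borel. B \<subseteq> E}"
  have ne: "?S E \<noteq> {}" for E :: "'a set"
    using bounded_borel_empty by blast
  have 1: "ennreal (\<mu> C) + ennreal (\<mu> D) \<le> pos_variation \<mu> (A \<union> B)"
    if C: "C \<in> ?S A" and D: "D \<in> ?S B" for C D
  proof -
    define C' where "C' = (if \<mu> C < 0 then {} else C)"
    define D' where "D' = (if \<mu> D < 0 then {} else D)"
    have C': "C' \<in> bounded_borel" "C' \<subseteq> A" and D': "D' \<in> bounded_borel" "D' \<subseteq> B"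
      using C D by (auto simp: C'_def D'_def)
    have nn: "0 \<le> \<mu> C'" "0 \<le> \<mu> D'"
      using M_loc_empty[OF \<mu>] by (auto simp: C'_def D'_def)
    have "ennreal (\<mu> C) + ennreal (\<mu> D) = ennreal (\<mu> C') + ennreal (\<mu> D')"
      using M_loc_empty[OF \<mu>] by (auto simp: C'_def D'_def ennreal_neg)
    also have "\<dots> = ennreal (\<mu> (C' \<union> D'))"
      using nn C' D' disj by (subst M_loc_Un[OF \<mu>]) (auto simp: ennreal_plus)
    also have "\<dots> \<le> pos_variation \<mu> (A \<union> B)"
      using C' D' by (intro pos_variation_upper bounded_borel_Un) auto
    finally show ?thesis .
  qed
  have "pos_variation \<mu> A + pos_variation \<mu> B
      = (SUP C\<in>?S A. ennreal (\<mu> C) + (SUP D\<in>?S B. ennreal (\<mu> D)))"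
    unfolding pos_variation_def by (rule ennreal_SUP_add_left[OF ne, symmetric])
  also have "\<dots> = (SUP C\<in>?S A. SUP D\<in>?S B. ennreal (\<mu> C) + ennreal (\<mu> D))"
    by (intro SUP_cong refl) (simp add: ennreal_SUP_add_right[OF ne])
  also have "\<dots> \<le> pos_variation \<mu> (A \<union> B)"
    by (intro SUP_least 1)
  finally show ?thesis .
qed

lemma pos_variation_countably_additive:
  assumes \<mu>: "\<mu> \<in> M_loc"
  shows "countably_additive (sets borel) (pos_variation \<mu>)"
  unfolding countably_additive_def
proof (intro allI impI antisym)
  fix A :: "nat \<Rightarrow> 'a set"
  assume A: "range A \<subseteq> sets borel" and disj: "disjoint_family A"
  have part: "(\<Sum>i<n. pos_variation \<mu> (A i)) \<le> pos_variation \<mu> (\<Union>i<n. A i)" for n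
  proof (induction n)
    case 0
    show ?case by simp
  next
    case (Suc n)
    have "A i \<inter> A n = {}" if "i < n" for i
      using disjoint_family_onD[OF disj, of i n] that by simp
    then have "(\<Union>i<n. A i) \<inter> A n = {}"
      by blast
    then have "pos_variation \<mu> (\<Union>i<n. A i) + pos_variation \<mu> (A n)
        \<le> pos_variation \<mu> ((\<Union>i<n. A i) \<union> A n)"
      by (rule pos_variation_superadditive[OF \<mu>])
    also have "(\<Union>i<n. A i) \<union> A n = (\<Union>i<Suc n. A i)"
      by (auto simp: lessThan_Suc)
    finally show ?case
      using add_right_mono[OF Suc.IH, of "pos_variation \<mu> (A n)"]
      by (simp only: sum.lessThan_Suc order_trans)
  qed
  show "(\<Sum>i. pos_variation \<mu> (A i)) \<le> pos_variation \<mu> (\<Union>i. A i)"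
    unfolding suminf_eq_SUP
  proof (rule SUP_least)
    fix n
    have "pos_variation \<mu> (\<Union>i<n. A i) \<le> pos_variation \<mu> (\<Union>i. A i)"
      by (rule pos_variation_mono) auto
    with part show "(\<Sum>i<n. pos_variation \<mu> (A i)) \<le> pos_variation \<mu> (\<Union>i. A i)"
      by (rule order_trans)
  qed
  show "pos_variation \<mu> (\<Union>i. A i) \<le> (\<Sum>i. pos_variation \<mu> (A i))"
    unfolding pos_variation_def[of \<mu> "\<Union>i. A i"]
  proof (rule SUP_least)
    fix B assume "B \<in> {B \<in> bounded_borel. B \<subseteq> (\<Union>i. A i)}"
    then have B: "B \<in> bounded_borel" "B = (\<Union>i. B \<inter> A i)" by auto
    have BA: "B \<inter> A i \<in> bounded_borel" for i
      using A B(1) by (intro bounded_borel_subset[OF B(1)]) (auto simp: bounded_borel_def)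
    have "(\<lambda>i. \<mu> (B \<inter> A i)) sums \<mu> (\<Union>i. B \<inter> A i)"
    proof (rule M_loc_sums[OF \<mu> BA])
      show "disjoint_family (\<lambda>i. B \<inter> A i)"
        using disj by (auto simp: disjoint_family_on_def)
      show "bounded (\<Union>i. B \<inter> A i)"
        using B by (simp add: bounded_borel_def)
    qed
    then have "(\<lambda>n. ennreal (\<Sum>i<n. \<mu> (B \<inter> A i))) \<longlonglongrightarrow> ennreal (\<mu> B)"
      using B(2) by (intro tendsto_ennrealI) (simp add: sums_def)
    moreover have "ennreal (\<Sum>i<n. \<mu> (B \<inter> A i)) \<le> (\<Sum>i. pos_variation \<mu> (A i))" for n
    proof -
      have "ennreal (\<Sum>i<n. \<mu> (B \<inter> A i)) \<le> ennreal (\<Sum>i<n. max 0 (\<mu> (B \<inter> A i)))"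
        by (intro ennreal_leI sum_mono) auto
      also have "\<dots> = (\<Sum>i<n. ennreal (max 0 (\<mu> (B \<inter> A i))))"
        by (rule sum_ennreal[symmetric]) auto
      also have "\<dots> \<le> (\<Sum>i<n. pos_variation \<mu> (A i))"
        by (intro sum_mono) (auto simp: max_def intro!: pos_variation_upper BA)
      also have "\<dots> \<le> (\<Sum>i. pos_variation \<mu> (A i))"
        by (intro sum_le_suminf) auto
      finally show ?thesis .
    qed
    ultimately show "ennreal (\<mu> B) \<le> (\<Sum>i. pos_variation \<mu> (A i))"
      by (intro LIMSEQ_le_const2) auto
  qed
qed

lemma emeasure_pos_part:
  assumes "\<mu> \<in> M_loc" "E \<in> sets borel"
  shows "emeasure (pos_part \<mu>) E = (SUP B\<in>{B\<in>bounded_borel. B \<subseteq> E}. ennreal (\<mu> B))"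
proof -
  have "emeasure (pos_part \<mu>) E = pos_variation \<mu> E"
  proof (rule emeasure_measure_of[OF pos_part_def])
    show "countably_additive (sets (pos_part \<mu>)) (pos_variation \<mu>)"
      using pos_variation_countably_additive[OF assms(1)] by simp
  qed (use assms pos_variation_empty[OF assms(1)] in \<open>auto simp: positive_def\<close>)
  then show ?thesis by (simp add: pos_variation_def)
qed

lemma emeasure_neg_part:
  assumes "\<mu> \<in> M_loc" "E \<in> sets borel"
  shows "emeasure (neg_part \<mu>) E = (SUP B\<in>{B\<in>bounded_borel. B \<subseteq> E}. ennreal (- \<mu> B))"
  unfolding neg_part_def using assms by (intro emeasure_pos_part M_loc_uminus)

lemma emeasure_total_variation:
  assumes "E \<in> sets borel"
  shows "emeasure (total_variation \<mu>) E = emeasure (pos_part \<mu>) E + emeasure (neg_part \<mu>) E"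
proof (rule emeasure_measure_of[OF total_variation_def])
  show "countably_additive (sets (total_variation \<mu>))
      (\<lambda>E. emeasure (pos_part \<mu>) E + emeasure (neg_part \<mu>) E)"
    unfolding countably_additive_def by (auto simp: suminf_add[symmetric] suminf_emeasure)
qed (use assms in \<open>auto simp: positive_def\<close>)

lemma emeasure_pos_part_finite:
  assumes \<mu>: "\<mu> \<in> M_loc" and E: "E \<in> bounded_borel"
  shows "emeasure (pos_part \<mu>) E < \<infinity>"
proof (rule ccontr)
  let ?V = "emeasure (pos_part \<mu>)"
  let ?P = "\<lambda>G. G \<in> bounded_borel \<and> ?V G = \<infinity>"
  assume "\<not> ?V E < \<infinity>"
  then have E\<^sub>0: "?P E" using E by (auto simp flip: less_top)
  have step: "\<exists>H. ?P H \<and> H \<subseteq> G \<and> \<bar>\<mu> (G - H)\<bar> > 1" if G: "?P G" for G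
  proof -
    have Gb: "G \<in> sets borel" using G by (simp add: bounded_borel_def)
    have "ennreal (1 + \<bar>\<mu> G\<bar>) < (SUP B\<in>{B\<in>bounded_borel. B \<subseteq> G}. ennreal (\<mu> B))"
      unfolding emeasure_pos_part[OF \<mu> Gb, symmetric] using G
      by (simp add: ennreal_less_top del: ennreal_plus)
    then obtain A where A: "A \<in> bounded_borel" "A \<subseteq> G" "ennreal (1 + \<bar>\<mu> G\<bar>) < ennreal (\<mu> A)"
      by (auto simp: less_SUP_iff)
    have Ab: "A \<in> sets borel" using A by (simp add: bounded_borel_def)
    have D: "G - A \<in> bounded_borel"
      using bounded_borel_subset[of G "G - A"] G Gb Ab by auto
    have mA: "\<mu> A > 1 + \<bar>\<mu> G\<bar>" using A(3) by (simp add: ennreal_less_iff del: ennreal_plus)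
    have "\<mu> (A \<union> (G - A)) = \<mu> A + \<mu> (G - A)" by (rule M_loc_Un[OF \<mu> A(1) D]) auto
    moreover have AG: "A \<union> (G - A) = G" using A(2) by auto
    ultimately have mD: "\<bar>\<mu> (G - A)\<bar> > 1" using mA by auto
    have "?V A + ?V (G - A) = ?V G"
      using plus_emeasure[of A "pos_part \<mu>" "G - A"] Ab Gb AG by auto
    then have "?V A = \<infinity> \<or> ?V (G - A) = \<infinity>" using G by auto
    then show ?thesis
    proof
      assume "?V A = \<infinity>"
      then show ?thesis using A mD by blast
    next
      assume "?V (G - A) = \<infinity>"
      moreover have "G - (G - A) = A" using A(2) by auto
      ultimately show ?thesis using D mA by (intro exI[of _ "G - A"]) auto
    qed
  qed
  have "\<exists>G. \<forall>n. ?P (G n) \<and> (G (Suc n) \<subseteq> G n \<and> \<bar>\<mu> (G n - G (Suc n))\<bar> > 1)"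
  proof (rule dependent_nat_choice)
    show "\<exists>x. ?P x" using E\<^sub>0 by (rule exI)
    show "\<exists>y. ?P y \<and> (y \<subseteq> x \<and> \<bar>\<mu> (x - y)\<bar> > 1)" if "?P x" for x and n :: nat
      using step[OF that] .
  qed
  then obtain G where all: "\<forall>n. ?P (G n) \<and> (G (Suc n) \<subseteq> G n \<and> \<bar>\<mu> (G n - G (Suc n))\<bar> > 1)"
    by (elim exE)
  have G: "?P (G n)" "G (Suc n) \<subseteq> G n" "\<bar>\<mu> (G n - G (Suc n))\<bar> > 1" for n
    using all[rule_format, of n] by simp_all
  have anti: "G n \<subseteq> G m" if "m \<le> n" for m n
    using that by (rule lift_Suc_antimono_le[where f = G, OF G(2)])
  have "(\<lambda>n. \<mu> (G n - G (Suc n))) sums \<mu> (\<Union>n. G n - G (Suc n))"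
  proof (rule M_loc_sums[OF \<mu>])
    have Gb: "G n \<in> sets borel" for n
      using G(1)[of n] by (simp add: bounded_borel_def)
    show "G n - G (Suc n) \<in> bounded_borel" for n
      by (rule bounded_borel_subset[of "G n"]) (simp_all add: G(1) Gb sets.Diff)
    have dj: "(G m - G (Suc m)) \<inter> (G n - G (Suc n)) = {}" if "m < n" for m n
    proof -
      have "G n \<subseteq> G (Suc m)" using that by (intro anti) simp
      then show ?thesis by blast
    qed
    show "disjoint_family (\<lambda>n. G n - G (Suc n))"
      unfolding disjoint_family_on_def
    proof (intro ballI impI)
      fix m n :: nat
      assume "m \<noteq> n"
      then consider "m < n" | "n < m" by linarith
      then show "(G m - G (Suc m)) \<inter> (G n - G (Suc n)) = {}"
        using dj[of m n] dj[of n m] by cases (simp_all only: Int_commute)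
    qed
    have "bounded (G 0)" using G(1)[of 0] by (simp add: bounded_borel_def)
    moreover have "(\<Union>n. G n - G (Suc n)) \<subseteq> G 0" using anti[of 0] by blast
    ultimately show "bounded (\<Union>n. G n - G (Suc n))" by (rule bounded_subset)
  qed
  then have "(\<lambda>n. \<mu> (G n - G (Suc n))) \<longlonglongrightarrow> 0"
    by (intro summable_LIMSEQ_zero sums_summable)
  then have "\<forall>\<^sub>F n in sequentially. \<bar>\<mu> (G n - G (Suc n))\<bar> < 1"
    by (auto dest!: tendstoD[where e = 1] simp: dist_real_def)
  then obtain n where "\<bar>\<mu> (G n - G (Suc n))\<bar> < 1"
    unfolding eventually_sequentially by blast
  with G(3)[of n] show False
    by simp
qed

lemma emeasure_neg_part_finite:
  "\<mu> \<in> M_loc \<Longrightarrow> E \<in> bounded_borel \<Longrightarrow> emeasure (neg_part \<mu>) E < \<infinity>"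
  unfolding neg_part_def by (intro emeasure_pos_part_finite M_loc_uminus)

lemma Jordan_decomposition:
  assumes \<mu>: "\<mu> \<in> M_loc" and E: "E \<in> bounded_borel"
  shows "\<mu> E = measure (pos_part \<mu>) E - measure (neg_part \<mu>) E"
proof -
  have Eb: "E \<in> sets borel" using E by (simp add: bounded_borel_def)
  have half: "measure (neg_part \<nu>) E \<le> measure (pos_part \<nu>) E - \<nu> E" if \<nu>: "\<nu> \<in> M_loc" for \<nu>
  proof -
    have "- \<nu> B \<le> measure (pos_part \<nu>) E - \<nu> E" if B: "B \<in> bounded_borel" "B \<subseteq> E" for B
    proof -
      have D: "E - B \<in> bounded_borel"
        using B E by (intro bounded_borel_subset[OF E]) (auto simp: bounded_borel_def)
      have "\<nu> (B \<union> (E - B)) = \<nu> B + \<nu> (E - B)" by (rule M_loc_Un[OF \<nu> B(1) D]) auto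
      moreover have "B \<union> (E - B) = E" using B by auto
      moreover have "ennreal (\<nu> (E - B)) \<le> emeasure (pos_part \<nu>) E"
        unfolding emeasure_pos_part[OF \<nu> Eb] using D by (intro SUP_upper) auto
      then have "\<nu> (E - B) \<le> measure (pos_part \<nu>) E"
        using emeasure_pos_part_finite[OF \<nu> E]
        by (simp add: emeasure_eq_ennreal_measure)
      ultimately show ?thesis by simp
    qed
    moreover from this[of "{}"] have nn: "0 \<le> measure (pos_part \<nu>) E - \<nu> E"
      by (simp add: M_loc_empty[OF \<nu>])
    ultimately have "emeasure (neg_part \<nu>) E \<le> ennreal (measure (pos_part \<nu>) E - \<nu> E)"
      unfolding emeasure_neg_part[OF \<nu> Eb] by (intro SUP_least ennreal_leI) auto
    then show ?thesis
      using nn unfolding measure_def[of "neg_part \<nu>"] by (simp add: enn2real_leI)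
  qed
  from half[OF \<mu>] half[OF M_loc_uminus[OF \<mu>]] show ?thesis
    by (simp add: neg_part_def)
qed


section \<open>Gaussian-weighted classes\<close>

definition M_weighted :: "real \<Rightarrow> ('a::euclidean_space set \<Rightarrow> real) set" where
  "M_weighted \<epsilon> = {\<mu> \<in> M_loc.
     (\<integral>\<^sup>+x. ennreal (exp (- \<epsilon> * (norm x)\<^sup>2)) \<partial>total_variation \<mu>) < \<infinity>}"

definition L1_loc :: "('a::euclidean_space \<Rightarrow> real) set" where
  "L1_loc = {f. \<forall>K. compact K \<longrightarrow> f absolutely_integrable_on K}"

definition L1_weighted :: "real \<Rightarrow> ('a::euclidean_space \<Rightarrow> real) set" where
  "L1_weighted \<epsilon> = {f \<in> L1_loc.
     (\<integral>\<^sup>+x. ennreal (exp (- \<epsilon> * (norm x)\<^sup>2) * \<bar>f x\<bar>) \<partial>lebesgue) < \<infinity>}"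


section \<open>The heat extension\<close>

text \<open>
  Integral of a non-negative function against a signed Radon measure.  In \<^typ>\<open>ereal\<close> the
  difference \<open>\<infinity> - \<infinity>\<close> is \<open>\<infinity>\<close>, so the value is finite exactly when the
  function is \<open>|\<mu>|\<close>-integrable.  If \<open>\<mu> \<ge> 0\<close> the value is the usual integral
  in \<open>[0, \<infinity>]\<close>.
\<close>

definition signed_integral ::
  "('a::euclidean_space set \<Rightarrow> real) \<Rightarrow> ('a \<Rightarrow> real) \<Rightarrow> ereal" where
  "signed_integral \<mu> f =
     enn2ereal (\<integral>\<^sup>+y. ennreal (f y) \<partial>pos_part \<mu>) - enn2ereal (\<integral>\<^sup>+y. ennreal (f y) \<partial>neg_part \<mu>)"

definition heat_ext ::
  "('a::euclidean_space set \<Rightarrow> real) \<Rightarrow> 'a \<Rightarrow> real \<Rightarrow> ereal" where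
  "heat_ext u\<^sub>0 x t = ereal (1 / (4 * pi * t) powr (real DIM('a) / 2)) *
     signed_integral u\<^sub>0 (\<lambda>y. exp (- (norm (x - y))\<^sup>2 / (4 * t)))"

definition T_max :: "real \<Rightarrow> real" where
  "T_max \<epsilon> = 1 / (4 * \<epsilon>)"

definition eps_at :: "real \<Rightarrow> real \<Rightarrow> real" where
  "eps_at \<epsilon> t = 1 / (4 * (T_max \<epsilon> - t))"

end

theory Submission
  imports Defs "HOL-Probability.Distributions"
begin

text \<open>
  Everything rests on one pointwise comparison of Gaussians with different widths and different
  centres: for \<open>0 < q < p\<close>, completing the square gives
  \<open>p |x - y|\<^sup>2 \<ge> q |y|\<^sup>2 - (p q / (p - q)) |x|\<^sup>2\<close>, so the narrower Gaussian, wherever it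
  is centred, lies below a constant multiple of the wider one centred at the origin
  (\<open>gaussian_le_wider_gaussian\<close>).

  For the growth bound take \<open>p = 1 / (4 t)\<close> and \<open>q = \<epsilon>\<close>; then \<open>q < p\<close> says \<open>t < T(\<epsilon>)\<close>, and the
  constant \<open>p q / (p - q)\<close> is exactly \<open>\<epsilon>(t)\<close>.  Integrating the comparison against \<open>|u\<^sub>0|\<close> yields
  the pointwise estimate \<open>|u(x,t)| \<le> C exp (\<epsilon>(t) |x|\<^sup>2)\<close>, with \<open>C\<close> a multiple of
  \<open>\<integral> exp (- \<epsilon> |y|\<^sup>2) d|u\<^sub>0|\<close>.  A function with this growth lies in \<open>L\<^sup>1\<^sub>\<delta>\<close> for every
  \<open>\<delta> > \<epsilon>(t)\<close> because \<open>exp (- (\<delta> - \<epsilon>(t)) |x|\<^sup>2)\<close> is integrable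
  (\<open>heat_ext_gaussian_growth\<close>, \<open>L1_weighted_gaussian_growth\<close>).

  For the converse, the same comparison with \<open>p = \<epsilon>\<close>, \<open>q = 1 / (4 t)\<close> and \<open>x - y\<close> in place
  of \<open>y\<close> bounds the weight \<open>exp (- \<epsilon> |y|\<^sup>2)\<close> by a multiple of the heat kernel centred at the single
  point \<open>x\<close>, whose \<open>u\<^sub>0\<close>-integral is finite.  A non-negative \<open>u\<^sub>0\<close> has no negative part, so
  there is no cancellation between the two parts and \<open>|u\<^sub>0|\<close> is the positive part
  (\<open>M_weighted_if_heat_ext_finite\<close>).
\<close>

section \<open>Gaussians\<close>

text \<open>
  The difference of the two sides is \<open>(p - q) |y - (p / (p - q)) x|\<^sup>2\<close>.
\<close>

lemma norm_diff_power2_lower_bound: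
  fixes x y :: "'a::real_inner"
  assumes "q < p"
  shows "q * (norm y)\<^sup>2 - p * q / (p - q) * (norm x)\<^sup>2 \<le> p * (norm (x - y))\<^sup>2"
proof -
  define r where "r = p / (p - q)"
  have r: "(p - q) * r = p" "p * q / (p - q) = p * r - p"
    using assms by (simp_all add: r_def field_simps)
  have "0 \<le> (p - q) * (norm (y - r *\<^sub>R x))\<^sup>2"
    using assms by simp
  also have "\<dots> = (p - q) * (norm y)\<^sup>2 - 2 * ((p - q) * r) * (x \<bullet> y) + ((p - q) * r) * r * (norm x)\<^sup>2"
    by (simp add: power2_norm_eq_inner inner_diff_left inner_diff_right inner_commute algebra_simps)
  also have "\<dots> = p * (norm (x - y))\<^sup>2 - (q * (norm y)\<^sup>2 - (p * r - p) * (norm x)\<^sup>2)"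
    unfolding r
    by (simp add: power2_norm_eq_inner inner_diff_left inner_diff_right inner_commute algebra_simps)
  finally show ?thesis
    unfolding r by simp
qed

lemma gaussian_le_wider_gaussian:
  fixes x y :: "'a::real_inner"
  assumes "q < p"
  shows "exp (- p * (norm (x - y))\<^sup>2) \<le> exp (p * q / (p - q) * (norm x)\<^sup>2) * exp (- q * (norm y)\<^sup>2)"
  using norm_diff_power2_lower_bound[OF assms, of y x] by (simp flip: exp_add)

text \<open>
  The squared norm is a sum over the coordinates, so the integrand is a product and the integral
  is a power of the one-dimensional one, where the integrand is a multiple of a normal density.
\<close>

lemma nn_integral_gaussian_finite:
  assumes "0 < c"
  shows "(\<integral>\<^sup>+x. ennreal (exp (- c * (norm x)\<^sup>2)) \<partial>(lborel :: 'a::euclidean_space measure)) < \<infinity>"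
proof -
  define s where "s = sqrt (1 / (2 * c))"
  have s: "0 < s" "s\<^sup>2 = 1 / (2 * c)"
    using assms by (auto simp: s_def)
  have "integrable lborel (\<lambda>x. sqrt (2 * pi * s\<^sup>2) * normal_density 0 s x)"
    using s by (intro integrable_mult_right integrable_normal_density) auto
  also have "(\<lambda>x. sqrt (2 * pi * s\<^sup>2) * normal_density 0 s x) = (\<lambda>x::real. exp (- c * x\<^sup>2))"
    using s assms by (auto simp: normal_density_def fun_eq_iff)
  finally have one_dim: "(\<integral>\<^sup>+x. ennreal (exp (- c * x\<^sup>2)) \<partial>(lborel :: real measure)) < \<infinity>"
    by (simp add: integrable_iff_bounded)
  have "ennreal (exp (- c * (norm x)\<^sup>2)) = (\<Prod>b\<in>Basis. ennreal (exp (- c * (x \<bullet> b)\<^sup>2)))" for x :: 'a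
  proof -
    have "(norm x)\<^sup>2 = (\<Sum>b\<in>Basis. (x \<bullet> b)\<^sup>2)"
      by (subst power2_norm_eq_inner, subst euclidean_inner) (simp add: power2_eq_square)
    then show ?thesis
      by (simp add: prod_ennreal sum_distrib_left exp_sum flip: sum_negf)
  qed
  then have "(\<integral>\<^sup>+x. ennreal (exp (- c * (norm x)\<^sup>2)) \<partial>(lborel :: 'a measure))
      = (\<Prod>b\<in>(Basis::'a set). \<integral>\<^sup>+x. ennreal (exp (- c * x\<^sup>2)) \<partial>lborel)"
    by (simp only:) (rule nn_integral_lborel_prod; simp)
  also have "\<dots> < \<infinity>"
    using one_dim by (simp add: power_less_top_ennreal)
  finally show ?thesis .
qed

lemma L1_weighted_gaussian_growth:
  fixes f :: "'a::euclidean_space \<Rightarrow> real"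
  assumes f[measurable]: "f \<in> borel_measurable borel"
    and growth: "\<And>x. \<bar>f x\<bar> \<le> C * exp (a * (norm x)\<^sup>2)" and "a < \<delta>"
  shows "f \<in> L1_weighted \<delta>"
proof -
  have "0 \<le> C"
    using growth[of 0] by simp
  have "f absolutely_integrable_on K" if "compact K" for K
  proof (rule measurable_bounded_by_integrable_imp_absolutely_integrable)
    show "f \<in> borel_measurable (lebesgue_on K)"
      by (intro measurable_restrict_space1 measurable_completion) simp
    show "K \<in> sets lebesgue"
      using that by (simp add: compact_imp_closed lmeasurable_compact fmeasurableD)
    have "set_integrable lborel K (\<lambda>x. C * exp (a * (norm x)\<^sup>2))"
      unfolding set_integrable_def using that
      by (intro borel_integrable_compact continuous_intros)
    then show "(\<lambda>x. C * exp (a * (norm x)\<^sup>2)) integrable_on K"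
      by (rule set_borel_integral_eq_integral(1))
  qed (use growth in simp)
  moreover have "(\<integral>\<^sup>+x. ennreal (exp (- \<delta> * (norm x)\<^sup>2) * \<bar>f x\<bar>) \<partial>lebesgue) < \<infinity>"
  proof -
    have "exp (- \<delta> * (norm x)\<^sup>2) * \<bar>f x\<bar> \<le> C * exp (- (\<delta> - a) * (norm x)\<^sup>2)" for x
    proof -
      have "exp (- \<delta> * (norm x)\<^sup>2) * \<bar>f x\<bar> \<le> exp (- \<delta> * (norm x)\<^sup>2) * (C * exp (a * (norm x)\<^sup>2))"
        by (intro mult_left_mono growth) simp
      also have "\<dots> = C * exp (- (\<delta> - a) * (norm x)\<^sup>2)"
        by (simp add: algebra_simps flip: exp_add)
      finally show ?thesis .
    qed
    then have "(\<integral>\<^sup>+x. ennreal (exp (- \<delta> * (norm x)\<^sup>2) * \<bar>f x\<bar>) \<partial>lebesgue)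
        \<le> (\<integral>\<^sup>+x. ennreal C * ennreal (exp (- (\<delta> - a) * (norm x)\<^sup>2)) \<partial>(lebesgue :: 'a measure))"
      using \<open>0 \<le> C\<close> by (intro nn_integral_mono) (simp add: ennreal_leI flip: ennreal_mult')
    also have "\<dots> = ennreal C * (\<integral>\<^sup>+x. ennreal (exp (- (\<delta> - a) * (norm x)\<^sup>2)) \<partial>(lborel :: 'a measure))"
      by (simp add: nn_integral_completion nn_integral_cmult)
    also have "\<dots> < \<infinity>"
      using nn_integral_gaussian_finite[where ?'a = 'a, of "\<delta> - a"] \<open>a < \<delta>\<close>
      by (simp add: ennreal_mult_less_top)
    finally show ?thesis .
  qed
  ultimately show ?thesis
    by (simp add: L1_weighted_def L1_loc_def)
qed

section \<open>Jordan parts and the signed integral\<close>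

text \<open>
  The Jordan parts are finite on balls.  Their \<open>\<sigma>\<close>-finiteness makes the heat extension, an integral
  with a parameter, a Borel function of \<open>x\<close>.
\<close>

lemma sigma_finite_measure_pos_part:
  fixes \<mu> :: "'a::euclidean_space set \<Rightarrow> real"
  assumes "\<mu> \<in> M_loc"
  shows "sigma_finite_measure (pos_part \<mu>)"
proof
  let ?A = "range (\<lambda>n::nat. cball (0::'a) (real n))"
  have "emeasure (pos_part \<mu>) (cball 0 (real n)) \<noteq> \<infinity>" for n :: nat
    using emeasure_pos_part_finite[OF assms, of "cball 0 (real n)"]
    by (simp add: bounded_borel_def)
  moreover have "\<Union>?A = UNIV"
    by (auto intro: real_arch_simple)
  ultimately show "\<exists>A. countable A \<and> A \<subseteq> sets (pos_part \<mu>) \<and> \<Union>A = space (pos_part \<mu>)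
      \<and> (\<forall>a\<in>A. emeasure (pos_part \<mu>) a \<noteq> \<infinity>)"
    by (intro exI[of _ ?A]) auto
qed

lemma sigma_finite_measure_neg_part:
  "\<mu> \<in> M_loc \<Longrightarrow> sigma_finite_measure (neg_part \<mu>)"
  unfolding neg_part_def by (intro sigma_finite_measure_pos_part M_loc_uminus)

lemma nn_integral_parts_le_total_variation:
  "(\<integral>\<^sup>+y. f y \<partial>pos_part \<mu>) \<le> (\<integral>\<^sup>+y. f y \<partial>total_variation \<mu>)"
  "(\<integral>\<^sup>+y. f y \<partial>neg_part \<mu>) \<le> (\<integral>\<^sup>+y. f y \<partial>total_variation \<mu>)"
  by (intro nn_integral_mono_measure; simp add: le_measure emeasure_total_variation)+

lemma emeasure_neg_part_nonneg_measure:
  assumes "\<mu> \<in> M_loc" "nonneg_measure \<mu>" "E \<in> sets borel"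
  shows "emeasure (neg_part \<mu>) E = 0"
  unfolding emeasure_neg_part[OF assms(1,3)] using assms(2)
  by (intro antisym SUP_least) (simp_all add: nonneg_measure_def ennreal_neg)

lemma neg_part_nonneg_measure:
  assumes "\<mu> \<in> M_loc" "nonneg_measure \<mu>"
  shows "neg_part \<mu> = null_measure borel"
  using assms by (intro measure_eqI) (simp_all add: emeasure_neg_part_nonneg_measure)

lemma total_variation_nonneg_measure:
  assumes "\<mu> \<in> M_loc" "nonneg_measure \<mu>"
  shows "total_variation \<mu> = pos_part \<mu>"
  using assms
  by (intro measure_eqI) (simp_all add: emeasure_total_variation emeasure_neg_part_nonneg_measure)

lemma signed_integral_nonneg_measure:
  assumes "\<mu> \<in> M_loc" "nonneg_measure \<mu>"
  shows "signed_integral \<mu> f = enn2ereal (\<integral>\<^sup>+y. ennreal (f y) \<partial>total_variation \<mu>)"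
  by (simp add: signed_integral_def neg_part_nonneg_measure[OF assms]
      total_variation_nonneg_measure[OF assms] zero_ennreal.rep_eq)

text \<open>
  Each Jordan part integrates \<open>f\<close> to a number in \<open>[0, K]\<close>, and the difference of two such numbers
  lies in \<open>[-K, K]\<close>.
\<close>

lemma abs_signed_integral_le:
  assumes "(\<integral>\<^sup>+y. ennreal (f y) \<partial>total_variation \<mu>) \<le> ennreal K" "0 \<le> K"
  shows "\<bar>signed_integral \<mu> f\<bar> \<le> ereal K"
proof -
  have bound: "\<exists>r. 0 \<le> r \<and> r \<le> K \<and> enn2ereal z = ereal r" if "z \<le> ennreal K" for z
  proof -
    have "enn2ereal z \<le> ereal K" "0 \<le> enn2ereal z"
      using that \<open>0 \<le> K\<close> by (simp_all add: less_eq_ennreal.rep_eq enn2ereal_ennreal)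
    then show ?thesis
      by (cases "enn2ereal z") auto
  qed
  obtain r where r: "0 \<le> r" "r \<le> K" "enn2ereal (\<integral>\<^sup>+y. ennreal (f y) \<partial>pos_part \<mu>) = ereal r"
    using bound[OF order_trans[OF nn_integral_parts_le_total_variation(1) assms(1)]] by blast
  obtain s where s: "0 \<le> s" "s \<le> K" "enn2ereal (\<integral>\<^sup>+y. ennreal (f y) \<partial>neg_part \<mu>) = ereal s"
    using bound[OF order_trans[OF nn_integral_parts_le_total_variation(2) assms(1)]] by blast
  show ?thesis
    unfolding signed_integral_def r(3) s(3) using r s by simp
qed

section \<open>The heat extension\<close>

lemma borel_measurable_heat_ext:
  assumes "\<mu> \<in> M_loc"
  shows "(\<lambda>x. heat_ext \<mu> x t) \<in> borel_measurable borel"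
proof -
  interpret P: sigma_finite_measure "pos_part \<mu>"
    by (rule sigma_finite_measure_pos_part[OF assms])
  interpret N: sigma_finite_measure "neg_part \<mu>"
    by (rule sigma_finite_measure_neg_part[OF assms])
  show ?thesis
    unfolding heat_ext_def signed_integral_def by measurable
qed

text \<open>
  In the comparison of Gaussians with \<open>p = 1 / (4 t)\<close> and \<open>q = \<epsilon>\<close> the factor that depends on \<open>x\<close>
  comes out of the integral over \<open>y\<close>, and \<open>p q / (p - q) = \<epsilon> / (1 - 4 \<epsilon> t)\<close> is its exponent.
\<close>

lemma heat_ext_gaussian_growth:
  fixes \<mu> :: "'a::euclidean_space set \<Rightarrow> real"
  assumes \<mu>: "\<mu> \<in> M_weighted \<epsilon>" and "0 < t" "\<epsilon> < 1 / (4 * t)"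
  obtains C where "\<And>x. \<bar>heat_ext \<mu> x t\<bar> \<le> ereal (C * exp (\<epsilon> / (1 - 4 * \<epsilon> * t) * (norm x)\<^sup>2))"
proof -
  define I where "I = (\<integral>\<^sup>+y. ennreal (exp (- \<epsilon> * (norm y)\<^sup>2)) \<partial>total_variation \<mu>)"
  define a where "a = \<epsilon> / (1 - 4 * \<epsilon> * t)"
  define k where "k = 1 / (4 * pi * t) powr (real DIM('a) / 2)"
  have I: "I = ennreal (enn2real I)"
    using \<mu> by (simp add: I_def M_weighted_def)
  have a: "1 / (4 * t) * \<epsilon> / (1 / (4 * t) - \<epsilon>) = a"
    using assms by (simp add: a_def field_simps)
  have "0 \<le> k"
    by (simp add: k_def)
  have "\<bar>heat_ext \<mu> x t\<bar> \<le> ereal (k * enn2real I * exp (a * (norm x)\<^sup>2))" for x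
  proof -
    have "(\<integral>\<^sup>+y. ennreal (exp (- (norm (x - y))\<^sup>2 / (4 * t))) \<partial>total_variation \<mu>)
        \<le> (\<integral>\<^sup>+y. ennreal (exp (a * (norm x)\<^sup>2)) * ennreal (exp (- \<epsilon> * (norm y)\<^sup>2)) \<partial>total_variation \<mu>)"
    proof (rule nn_integral_mono)
      fix y
      have "exp (- (norm (x - y))\<^sup>2 / (4 * t)) \<le> exp (a * (norm x)\<^sup>2) * exp (- \<epsilon> * (norm y)\<^sup>2)"
        using gaussian_le_wider_gaussian[OF \<open>\<epsilon> < 1 / (4 * t)\<close>, of x y, unfolded a] by simp
      then show "ennreal (exp (- (norm (x - y))\<^sup>2 / (4 * t)))
          \<le> ennreal (exp (a * (norm x)\<^sup>2)) * ennreal (exp (- \<epsilon> * (norm y)\<^sup>2))"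
        by (simp add: ennreal_leI flip: ennreal_mult)
    qed
    also have "\<dots> = ennreal (exp (a * (norm x)\<^sup>2)) * I"
      unfolding I_def by (rule nn_integral_cmult) simp
    also have "\<dots> = ennreal (exp (a * (norm x)\<^sup>2) * enn2real I)"
      by (subst I) (simp flip: ennreal_mult)
    finally have "\<bar>signed_integral \<mu> (\<lambda>y. exp (- (norm (x - y))\<^sup>2 / (4 * t)))\<bar>
        \<le> ereal (exp (a * (norm x)\<^sup>2) * enn2real I)" (is "\<bar>?S\<bar> \<le> _")
      by (rule abs_signed_integral_le) simp
    then obtain s where s: "?S = ereal s" "\<bar>s\<bar> \<le> exp (a * (norm x)\<^sup>2) * enn2real I"
      by (cases ?S) auto
    have "\<bar>k * s\<bar> \<le> k * (exp (a * (norm x)\<^sup>2) * enn2real I)"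
      using \<open>0 \<le> k\<close> s(2) by (simp add: abs_mult mult_left_mono)
    then show ?thesis
      unfolding heat_ext_def s(1) k_def[symmetric] by (simp add: mult_ac)
  qed
  then show ?thesis
    using that unfolding a_def by blast
qed

text \<open>
  Finiteness of \<open>u\<close> at one point suffices, since the comparison of Gaussians absorbs the shift
  of the centre into a constant.
\<close>

lemma M_weighted_if_heat_ext_finite:
  fixes \<mu> :: "'a::euclidean_space set \<Rightarrow> real"
  assumes \<mu>: "\<mu> \<in> M_loc" "nonneg_measure \<mu>"
    and "0 < t" "heat_ext \<mu> x t < \<infinity>" and \<epsilon>: "1 / (4 * t) < \<epsilon>"
  shows "\<mu> \<in> M_weighted \<epsilon>"
proof -
  define b where "b = \<epsilon> * (1 / (4 * t)) / (\<epsilon> - 1 / (4 * t)) * (norm x)\<^sup>2"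
  let ?J = "\<integral>\<^sup>+y. ennreal (exp (- (norm (x - y))\<^sup>2 / (4 * t))) \<partial>total_variation \<mu>"
  have "0 < 1 / (4 * pi * t) powr (real DIM('a) / 2)"
    using \<open>0 < t\<close> by simp
  then have "?J < \<infinity>"
    using \<open>heat_ext \<mu> x t < \<infinity>\<close>
    by (cases ?J) (auto simp: heat_ext_def signed_integral_nonneg_measure[OF \<mu>])
  have "(\<integral>\<^sup>+y. ennreal (exp (- \<epsilon> * (norm y)\<^sup>2)) \<partial>total_variation \<mu>)
      \<le> (\<integral>\<^sup>+y. ennreal (exp b) * ennreal (exp (- (norm (x - y))\<^sup>2 / (4 * t))) \<partial>total_variation \<mu>)"
  proof (rule nn_integral_mono)
    fix y
    have "exp (- \<epsilon> * (norm y)\<^sup>2) \<le> exp b * exp (- (norm (x - y))\<^sup>2 / (4 * t))"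
      using gaussian_le_wider_gaussian[OF \<epsilon>, of x "x - y"] by (simp add: b_def)
    then show "ennreal (exp (- \<epsilon> * (norm y)\<^sup>2))
        \<le> ennreal (exp b) * ennreal (exp (- (norm (x - y))\<^sup>2 / (4 * t)))"
      by (simp add: ennreal_leI flip: ennreal_mult)
  qed
  also have "\<dots> = ennreal (exp b) * ?J"
    by (rule nn_integral_cmult) simp
  also have "\<dots> < \<infinity>"
    using \<open>?J < \<infinity>\<close> by (simp add: ennreal_mult_less_top)
  finally show ?thesis
    using \<mu> by (simp add: M_weighted_def)
qed

theorem lemma3p2:
  fixes u\<^sub>0 :: "(real ^ 'n) set \<Rightarrow> real"
  assumes "u\<^sub>0 \<in> M_loc"
  shows
    "(\<forall>\<epsilon>>0. u\<^sub>0 \<in> M_weighted \<epsilon> \<longrightarrow>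
        (\<forall>t. 0 < t \<and> t < T_max \<epsilon> \<longrightarrow>
           eps_at \<epsilon> t = \<epsilon> / (1 - 4 * \<epsilon> * t) \<and>
           (\<forall>x. \<bar>heat_ext u\<^sub>0 x t\<bar> \<noteq> \<infinity>) \<and>
           (\<forall>\<delta>>eps_at \<epsilon> t. (\<lambda>x. real_of_ereal (heat_ext u\<^sub>0 x t)) \<in> L1_weighted \<delta>)))
     \<and>
     (nonneg_measure u\<^sub>0 \<longrightarrow>
        (\<forall>x. \<forall>t>0. heat_ext u\<^sub>0 x t < \<infinity> \<longrightarrow> (\<forall>\<epsilon>>1 / (4 * t). u\<^sub>0 \<in> M_weighted \<epsilon>)))"
proof (intro conjI allI impI)
  fix \<epsilon> t :: real
  assume "0 < \<epsilon>" and u\<^sub>0: "u\<^sub>0 \<in> M_weighted \<epsilon>" and t: "0 < t \<and> t < T_max \<epsilon>"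
  have "0 < t" "\<epsilon> < 1 / (4 * t)"
    using t \<open>0 < \<epsilon>\<close> by (auto simp: T_max_def field_simps)
  show eps_at: "eps_at \<epsilon> t = \<epsilon> / (1 - 4 * \<epsilon> * t)"
    using t \<open>0 < \<epsilon>\<close> by (simp add: eps_at_def T_max_def field_simps)
  obtain C where C: "\<bar>heat_ext u\<^sub>0 x t\<bar> \<le> ereal (C * exp (eps_at \<epsilon> t * (norm x)\<^sup>2))" for x
    using heat_ext_gaussian_growth[OF u\<^sub>0 \<open>0 < t\<close> \<open>\<epsilon> < 1 / (4 * t)\<close>] unfolding eps_at by blast
  show "\<bar>heat_ext u\<^sub>0 x t\<bar> \<noteq> \<infinity>" for x
    using C[of x] by auto
  fix \<delta>
  assume "eps_at \<epsilon> t < \<delta>"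
  have "\<bar>real_of_ereal (heat_ext u\<^sub>0 x t)\<bar> \<le> C * exp (eps_at \<epsilon> t * (norm x)\<^sup>2)" for x
    using C[of x] by (cases "heat_ext u\<^sub>0 x t") auto
  moreover have "(\<lambda>x. real_of_ereal (heat_ext u\<^sub>0 x t)) \<in> borel_measurable borel"
    using borel_measurable_heat_ext[OF assms] by measurable
  ultimately show "(\<lambda>x. real_of_ereal (heat_ext u\<^sub>0 x t)) \<in> L1_weighted \<delta>"
    using L1_weighted_gaussian_growth \<open>eps_at \<epsilon> t < \<delta>\<close> by blast
qed (use assms M_weighted_if_heat_ext_finite in blast)

end
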